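(* Let $G$ be a group acting on a finite set $X$. If $\tau\in\mathrm{End}_G(X)$ is an elementary collapsing (of some type) and $\eta\in\mathrm{End}_G(X)$ satisfies $\tau\sim_{\mathcal{D}}\eta$, then $\eta$ is also an elementary collapsing of some type.
   Context: $\mathrm{End}_G(X)$ is the monoid, under composition $(fg)(x)=f(g(x))$, of all $G$-equivariant functions $X\to X$. Write $S=\mathrm{End}_G(X)$. For $a,b\in S$: $a\sim_{\mathcal{L}} b$ means $Sa=Sb$; $a\sim_{\mathcal{R}} b$ means $aS=bS$; $a\sim_{\mathcal{D}} b$ means there is $c\in S$ with $a\sim_{\mathcal{L}} c$ and $c\sim_{\mathcal{R}} b$. $G_x$ is the stabilizer and $Gx$ the orbit of $x$. The kernel of $f:X\to X$ is $\ker(f)=\{(x,y)\in X\times X : f(x)=f(y)\}$. For a subgroup $K\le G$ and a subset $N\subseteq G$, $[K]_N=\{n^{-1}Kn : n\in N\}$; $N_H=N_G(H)$ is the normalizer of a subgroup $H\le G$. Definition. For subgroups $H,K\le G$, $\tau\in\mathrm{End}_G(X)$ is an elementary collapsing of type $(H,[K]_{N_H})$ if there exist $x,y\in X$ such that: (i) $Gx\neq Gy$; (ii) $G_x=H$; (iii) $[G_y]_{N_H}=[G_{\tau(x)}]_{N_H}=[K]_{N_H}$; (iv) $\ker(\tau)=\{(a,a): a\in X\}\cup\{(g\cdot x,g\cdot y),(g\cdot y,g\cdot x): g\in G\}\cup\{(g\cdot x,h\cdot x),(h\cdot x,g\cdot x): g,h\in G,\ h^{-1}g\in G_y\}$. 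*)

theory Defs
  imports "HOL-Algebra.Group_Action"
begin

text \<open>The monoid of all \<open>G\<close>-equivariant maps \<open>X \<rightarrow> X\<close>. As in \<^const>\<open>BijGroup\<close>, maps are extensional
  (undefined outside \<open>X\<close>), so that equality of elements is equality of functions on \<open>X\<close>.\<close>

definition End_monoid ::
  "('a, 'm) monoid_scheme \<Rightarrow> 'x set \<Rightarrow> ('a \<Rightarrow> 'x \<Rightarrow> 'x) \<Rightarrow> ('x \<Rightarrow> 'x) monoid"
  where "End_monoid G X \<phi> =
    \<lparr>carrier = {f \<in> X \<rightarrow>\<^sub>E X. \<forall>g \<in> carrier G. \<forall>x \<in> X. f (\<phi> g x) = \<phi> g (f x)},
     mult = compose X,
     one = (\<lambda>x \<in> X. x)\<rparr>"

definition green_L :: "('s, 'm) monoid_scheme \<Rightarrow> 's \<Rightarrow> 's \<Rightarrow> bool"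
  where "green_L S a b \<longleftrightarrow> carrier S #>\<^bsub>S\<^esub> a = carrier S #>\<^bsub>S\<^esub> b"

definition green_R :: "('s, 'm) monoid_scheme \<Rightarrow> 's \<Rightarrow> 's \<Rightarrow> bool"
  where "green_R S a b \<longleftrightarrow> a <#\<^bsub>S\<^esub> carrier S = b <#\<^bsub>S\<^esub> carrier S"

definition green_D :: "('s, 'm) monoid_scheme \<Rightarrow> 's \<Rightarrow> 's \<Rightarrow> bool"
  where "green_D S a b \<longleftrightarrow> (\<exists>c \<in> carrier S. green_L S a c \<and> green_R S c b)"

definition map_kernel :: "'x set \<Rightarrow> ('x \<Rightarrow> 'y) \<Rightarrow> ('x \<times> 'x) set"
  where "map_kernel X f = {(a, b). a \<in> X \<and> b \<in> X \<and> f a = f b}"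

definition conjugates :: "('a, 'm) monoid_scheme \<Rightarrow> 'a set \<Rightarrow> 'a set \<Rightarrow> 'a set set"
  where "conjugates G N K = {inv\<^bsub>G\<^esub> n <#\<^bsub>G\<^esub> K #>\<^bsub>G\<^esub> n | n. n \<in> N}"

text \<open>\<open>elementary_collapsing G X \<phi> H K \<tau>\<close>: the map \<open>\<tau>\<close> is an elementary collapsing of type
  \<open>(H, [K])\<close>, where \<open>[K]\<close> is the set of conjugates of \<open>K\<close> by elements of the normalizer of \<open>H\<close>.
  The definition depends on \<open>K\<close> only through \<open>[K]\<close>.\<close>

definition elementary_collapsing ::
  "('a, 'm) monoid_scheme \<Rightarrow> 'x set \<Rightarrow> ('a \<Rightarrow> 'x \<Rightarrow> 'x) \<Rightarrow> 'a set \<Rightarrow> 'a set \<Rightarrow> ('x \<Rightarrow> 'x) \<Rightarrow> bool"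
  where "elementary_collapsing G X \<phi> H K \<tau> \<longleftrightarrow>
    subgroup H G \<and> subgroup K G \<and> \<tau> \<in> carrier (End_monoid G X \<phi>) \<and>
    (\<exists>x \<in> X. \<exists>y \<in> X.
       orbit G \<phi> x \<noteq> orbit G \<phi> y \<and>
       stabilizer G \<phi> x = H \<and>
       conjugates G (normalizer G H) (stabilizer G \<phi> y) =
         conjugates G (normalizer G H) (stabilizer G \<phi> (\<tau> x)) \<and>
       conjugates G (normalizer G H) (stabilizer G \<phi> (\<tau> x)) = conjugates G (normalizer G H) K \<and>
       map_kernel X \<tau> =
         {(a, a) | a. a \<in> X}
         \<union> (\<Union>g \<in> carrier G. {(\<phi> g x, \<phi> g y), (\<phi> g y, \<phi> g x)})
         \<union> (\<Union>g \<in> carrier G. \<Union>h \<in> {h \<in> carrier G. inv\<^bsub>G\<^esub> h \<otimes>\<^bsub>G\<^esub> g \<in> stabilizer G \<phi> y}.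
              {(\<phi> g x, \<phi> h x), (\<phi> h x, \<phi> g x)}))"

lemma (in group_action) monoid_End_monoid: "monoid (End_monoid G E \<phi>)"
proof (rule monoidI)
  fix f g h assume "f \<in> carrier (End_monoid G E \<phi>)" "g \<in> carrier (End_monoid G E \<phi>)"
    "h \<in> carrier (End_monoid G E \<phi>)"
  then show "f \<otimes>\<^bsub>End_monoid G E \<phi>\<^esub> g \<otimes>\<^bsub>End_monoid G E \<phi>\<^esub> h
      = f \<otimes>\<^bsub>End_monoid G E \<phi>\<^esub> (g \<otimes>\<^bsub>End_monoid G E \<phi>\<^esub> h)"
    by (auto simp: End_monoid_def compose_def fun_eq_iff restrict_def PiE_iff)
qed (auto simp: End_monoid_def compose_def PiE_iff extensional_def fun_eq_iff
       intro: element_image split: if_splits)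

end

theory Submission
  imports Defs
begin

text \<open>An equivariant \<open>\<tau>\<close> is an elementary collapsing iff it is injective off some orbit \<open>Gx\<close> and
  \<open>\<tau> x = \<tau> y\<close> for some \<open>y\<close> off that orbit: condition (iii) is a consequence of (iv). This
  criterion depends only on the kernel, hence is invariant under \<open>\<L>\<close>. If \<open>c\<close> satisfies it and
  \<open>c = \<eta> s\<close>, \<open>\<eta> = c t\<close>, then \<open>s\<close> embeds \<open>X - Gx\<close> into \<open>X\<close>, and counting orbits shows that
  the image misses exactly one orbit \<open>Gx'\<close>. Off that orbit \<open>\<eta>\<close> is injective, because \<open>\<eta> s = c\<close>
  is injective on \<open>X - Gx\<close>; and \<open>\<eta> x'\<close> lies in \<open>c X = c (X - Gx) = \<eta> (X - Gx')\<close>.\<close>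

section \<open>Green's relations in the endomorphism monoid\<close>

lemma End_monoidD:
  assumes "f \<in> carrier (End_monoid G X \<phi>)"
  shows "x \<in> X \<Longrightarrow> f x \<in> X"
    and "g \<in> carrier G \<Longrightarrow> x \<in> X \<Longrightarrow> f (\<phi> g x) = \<phi> g (f x)"
  using assms by (auto simp: End_monoid_def)

text \<open>Since the monoid has a unit, \<open>a\<close> and \<open>b\<close> lie in each other's
  left ideals, so each is the other followed by a map. Postcomposition can only enlarge a kernel,
  which gives both inclusions.\<close>

lemma green_L_imp_map_kernel_eq:
  assumes a: "a \<in> carrier (End_monoid G X \<phi>)" and b: "b \<in> carrier (End_monoid G X \<phi>)"
    and M: "monoid (End_monoid G X \<phi>)" and L: "green_L (End_monoid G X \<phi>) a b"
  shows "map_kernel X a = map_kernel X b"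
proof -
  have factor: "\<exists>s. \<forall>x\<in>X. q x = s (p x)"
    if q: "q \<in> carrier (End_monoid G X \<phi>)" and "green_L (End_monoid G X \<phi>) p q" for p q
  proof -
    have "\<one>\<^bsub>End_monoid G X \<phi>\<^esub> \<otimes>\<^bsub>End_monoid G X \<phi>\<^esub> q \<in> carrier (End_monoid G X \<phi>) #>\<^bsub>End_monoid G X \<phi>\<^esub> q"
      using M by (auto simp: r_coset_def monoid.one_closed)
    then have "q \<in> carrier (End_monoid G X \<phi>) #>\<^bsub>End_monoid G X \<phi>\<^esub> p"
      using that M by (simp add: green_L_def monoid.l_one)
    then obtain s where "q = compose X s p"
      by (auto simp: r_coset_def End_monoid_def)
    then show ?thesis by (auto simp: compose_eq)
  qed
  from factor[OF b L] factor[OF a] L show ?thesis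
    by (fastforce simp: map_kernel_def green_L_def)
qed

text \<open>\<open>b\<close> lies in its own right ideal because of the unit, hence in that of
  \<open>a\<close>.\<close>

lemma green_R_factor:
  assumes b: "b \<in> carrier (End_monoid G X \<phi>)" and M: "monoid (End_monoid G X \<phi>)"
    and R: "green_R (End_monoid G X \<phi>) a b"
  obtains s where "s \<in> carrier (End_monoid G X \<phi>)" "\<And>x. x \<in> X \<Longrightarrow> b x = a (s x)"
proof -
  have "b \<otimes>\<^bsub>End_monoid G X \<phi>\<^esub> \<one>\<^bsub>End_monoid G X \<phi>\<^esub> \<in> b <#\<^bsub>End_monoid G X \<phi>\<^esub> carrier (End_monoid G X \<phi>)"
    using M by (auto simp: l_coset_def monoid.one_closed)
  then have "b \<in> a <#\<^bsub>End_monoid G X \<phi>\<^esub> carrier (End_monoid G X \<phi>)"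
    using R b M by (simp add: green_R_def monoid.r_one)
  then obtain s where "s \<in> carrier (End_monoid G X \<phi>)" "b = compose X a s"
    by (auto simp: l_coset_def End_monoid_def)
  then show ?thesis by (intro that[of s]) (auto simp: compose_eq)
qed

context group_action
begin

section \<open>Orbits and stabilizers\<close>

lemma orbit_subset: "x \<in> E \<Longrightarrow> orbit G \<phi> x \<subseteq> E"
  by (auto simp: orbit_def element_image)

lemma orbit_eq_iff:
  assumes "x \<in> E" "y \<in> E"
  shows "orbit G \<phi> x = orbit G \<phi> y \<longleftrightarrow> x \<in> orbit G \<phi> y"
proof
  assume "orbit G \<phi> x = orbit G \<phi> y" with orbit_refl[OF assms(1)] show "x \<in> orbit G \<phi> y" by simp
next
  assume xy: "x \<in> orbit G \<phi> y"
  then have yx: "y \<in> orbit G \<phi> x" using orbit_sym assms by blast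
  show "orbit G \<phi> x = orbit G \<phi> y"
    using orbit_trans xy yx assms orbit_subset by (meson subsetD subsetI subset_antisym)
qed

lemma act_orbit_complement:
  assumes "x \<in> E" "y \<in> E - orbit G \<phi> x" "g \<in> carrier G"
  shows "\<phi> g y \<in> E - orbit G \<phi> x"
proof -
  have "\<phi> g y \<in> orbit G \<phi> y" using assms by (auto simp: orbit_def)
  then show ?thesis
    using assms element_image by (metis DiffD1 DiffD2 DiffI orbit_sym orbit_trans)
qed

text \<open>This decodes the last part of condition (iv): the pairs listed there are the pairs of
  \<open>\<phi> g x\<close> and \<open>\<phi> h x\<close> with
  \<open>\<phi> g y = \<phi> h y\<close>.\<close>

lemma act_eq_iff_stabilizer:
  assumes "x \<in> E" "g \<in> carrier G" "h \<in> carrier G"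
  shows "\<phi> g x = \<phi> h x \<longleftrightarrow> inv\<^bsub>G\<^esub> h \<otimes>\<^bsub>G\<^esub> g \<in> stabilizer G \<phi> x"
proof -
  interpret group G using group_hom group_hom.axioms(1) by blast
  have "\<phi> (inv h \<otimes> g) x = \<phi> (inv h) (\<phi> g x)" "\<phi> (inv h) (\<phi> h x) = x"
    using assms composition_rule[of x "inv h" h] composition_rule[of x "inv h" g] id_eq_one
    by (auto simp: fun_eq_iff restrict_def split: if_splits)
  moreover have "\<phi> h (\<phi> (inv h) (\<phi> g x)) = \<phi> g x"
    using assms composition_rule[of "\<phi> g x" h "inv h"] id_eq_one element_image
    by (metis inv_closed r_inv restrict_apply)
  ultimately show ?thesis
    using assms by (auto simp: stabilizer_def)
qed

lemma End_monoid_image_orbit: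
  assumes "f \<in> carrier (End_monoid G E \<phi>)" "x \<in> E"
  shows "f ` orbit G \<phi> x = orbit G \<phi> (f x)"
proof -
  have "orbit G \<phi> z = (\<lambda>g. \<phi> g z) ` carrier G" for z by (auto simp: orbit_def)
  then show ?thesis
    using End_monoidD(2)[OF assms(1) _ assms(2)] by (simp add: image_image cong: image_cong_simp)
qed

section \<open>The injectivity criterion for elementary collapsings\<close>

lemma elementary_collapsing_iff:
  assumes \<tau>: "\<tau> \<in> carrier (End_monoid G E \<phi>)"
  shows "(\<exists>H K. elementary_collapsing G E \<phi> H K \<tau>) \<longleftrightarrow>
    (\<exists>x\<in>E. inj_on \<tau> (E - orbit G \<phi> x) \<and> \<tau> x \<in> \<tau> ` (E - orbit G \<phi> x))"
proof
  interpret group G using group_hom group_hom.axioms(1) by blast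
  {
    assume "\<exists>H K. elementary_collapsing G E \<phi> H K \<tau>"
    then obtain x y where x: "x \<in> E" and y: "y \<in> E" and ne: "orbit G \<phi> x \<noteq> orbit G \<phi> y"
      and ker: "map_kernel E \<tau> =
         {(a, a) | a. a \<in> E}
         \<union> (\<Union>g \<in> carrier G. {(\<phi> g x, \<phi> g y), (\<phi> g y, \<phi> g x)})
         \<union> (\<Union>g \<in> carrier G. \<Union>h \<in> {h \<in> carrier G. inv\<^bsub>G\<^esub> h \<otimes>\<^bsub>G\<^esub> g \<in> stabilizer G \<phi> y}.
              {(\<phi> g x, \<phi> h x), (\<phi> h x, \<phi> g x)})"
      unfolding elementary_collapsing_def by blast
    have "inj_on \<tau> (E - orbit G \<phi> x)"
    proof (rule inj_onI)
      fix a b assume ab: "a \<in> E - orbit G \<phi> x" "b \<in> E - orbit G \<phi> x" "\<tau> a = \<tau> b"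
      then have "(a, b) \<in> map_kernel E \<tau>" by (simp add: map_kernel_def)
      \<comment> \<open>Every pair of \<open>ker\<close> outside the diagonal has a coordinate in
        the orbit of \<open>x\<close>.\<close>
      then show "a = b" using ab unfolding ker by (auto simp: orbit_def)
    qed
    moreover have "(\<phi> \<one> x, \<phi> \<one> y) \<in> map_kernel E \<tau>" unfolding ker by blast
    then have "\<tau> x = \<tau> y"
      using x y id_eq_one by (auto simp: map_kernel_def) (metis restrict_apply)
    moreover have "y \<in> E - orbit G \<phi> x" using ne x y orbit_eq_iff[of y x] by auto
    ultimately show "\<exists>x\<in>E. inj_on \<tau> (E - orbit G \<phi> x) \<and> \<tau> x \<in> \<tau> ` (E - orbit G \<phi> x)"
      using x by auto
  next
    assume "\<exists>x\<in>E. inj_on \<tau> (E - orbit G \<phi> x) \<and> \<tau> x \<in> \<tau> ` (E - orbit G \<phi> x)"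
    then obtain x y where x: "x \<in> E" and y: "y \<in> E" "y \<notin> orbit G \<phi> x" and eq: "\<tau> x = \<tau> y"
      and inj: "inj_on \<tau> (E - orbit G \<phi> x)" by auto
    have gy: "\<phi> g y \<in> E - orbit G \<phi> x" if "g \<in> carrier G" for g
      using act_orbit_complement x y that by simp
    have geq: "\<tau> (\<phi> g x) = \<tau> (\<phi> g y)" if "g \<in> carrier G" for g
      using that x y eq \<tau> by (simp add: End_monoidD(2))
    \<comment> \<open>This yields condition (iii). If \<open>g\<close> fixes
      \<open>\<tau> y\<close>, then \<open>\<phi> g y\<close> and \<open>y\<close> have the same
      image and both lie off the orbit of \<open>x\<close>, where \<tau> is injective. The other
      inclusion is equivariance.\<close>
    have "stabilizer G \<phi> y = stabilizer G \<phi> (\<tau> y)"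
    proof -
      have "\<phi> g y = y" if g: "g \<in> carrier G" "\<phi> g (\<tau> y) = \<tau> y" for g
        using inj_onD[OF inj _ gy[OF g(1)]] y g \<tau> by (simp add: End_monoidD(2))
      then show ?thesis
        using \<tau> y by (auto simp: stabilizer_def) (metis End_monoidD(2))
    qed
    moreover have "map_kernel E \<tau> =
         {(a, a) | a. a \<in> E}
         \<union> (\<Union>g \<in> carrier G. {(\<phi> g x, \<phi> g y), (\<phi> g y, \<phi> g x)})
         \<union> (\<Union>g \<in> carrier G. \<Union>h \<in> {h \<in> carrier G. inv\<^bsub>G\<^esub> h \<otimes>\<^bsub>G\<^esub> g \<in> stabilizer G \<phi> y}.
              {(\<phi> g x, \<phi> h x), (\<phi> h x, \<phi> g x)})" (is "_ = ?R")
    proof (intro equalityI subrelI)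
      fix a b assume "(a, b) \<in> map_kernel E \<tau>"
      then have ab: "a \<in> E" "b \<in> E" "\<tau> a = \<tau> b" by (auto simp: map_kernel_def)
      \<comment> \<open>A point \<open>\<phi> g x\<close> can be traded for
        \<open>\<phi> g y\<close>, which has the same image but lies where \<tau> is injective. So
        each case reduces to injectivity off the orbit.\<close>
      consider "a \<notin> orbit G \<phi> x" "b \<notin> orbit G \<phi> x"
        | g where "g \<in> carrier G" "a = \<phi> g x" "b \<notin> orbit G \<phi> x"
        | g where "g \<in> carrier G" "b = \<phi> g x" "a \<notin> orbit G \<phi> x"
        | g h where "g \<in> carrier G" "h \<in> carrier G" "a = \<phi> g x" "b = \<phi> h x"
        by (auto simp: orbit_def)
      then show "(a, b) \<in> ?R"
      proof cases
        case 1
        then show ?thesis using inj ab by (auto dest: inj_onD)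
      next
        case 2
        then have "b = \<phi> g y" using inj_onD[OF inj _ _ gy, of b g] geq ab by auto
        with 2 show ?thesis by blast
      next
        case 3
        then have "a = \<phi> g y" using inj_onD[OF inj _ _ gy, of a g] geq ab by auto
        with 3 show ?thesis by blast
      next
        case 4
        then have "\<phi> g y = \<phi> h y" using inj_onD[OF inj _ gy gy, of g h] geq ab by auto
        then have "h \<in> {h \<in> carrier G. inv\<^bsub>G\<^esub> h \<otimes>\<^bsub>G\<^esub> g \<in> stabilizer G \<phi> y}"
          using 4 y act_eq_iff_stabilizer by simp
        with 4 show ?thesis by blast
      qed
    next
      fix a b assume "(a, b) \<in> ?R"
      \<comment> \<open>The unordered pairs absorb the symmetric duplicates in
        \<open>?R\<close>.\<close>
      then consider "a = b" "a \<in> E"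
        | g where "g \<in> carrier G" "{a, b} = {\<phi> g x, \<phi> g y}"
        | g h where "g \<in> carrier G" "h \<in> carrier G" "\<phi> g y = \<phi> h y" "{a, b} = {\<phi> g x, \<phi> h x}"
        by (auto simp: act_eq_iff_stabilizer[OF y(1)])
      then show "(a, b) \<in> map_kernel E \<tau>"
      proof cases
        case 1
        then show ?thesis by (simp add: map_kernel_def)
      next
        case 2
        then have "a \<in> E" "b \<in> E" "\<tau> a = \<tau> b"
          using geq x y element_image by (auto simp: doubleton_eq_iff)
        then show ?thesis by (simp add: map_kernel_def)
      next
        case 3
        then have "a \<in> E" "b \<in> E" "\<tau> a = \<tau> b"
          using geq x y element_image by (auto simp: doubleton_eq_iff)
        then show ?thesis by (simp add: map_kernel_def)
      qed
    qed
    moreover have "orbit G \<phi> x \<noteq> orbit G \<phi> y" using y orbit_refl by blast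
    ultimately have "elementary_collapsing G E \<phi> (stabilizer G \<phi> x) (stabilizer G \<phi> y) \<tau>"
      unfolding elementary_collapsing_def
      using x y(1) \<tau> eq stabilizer_subgroup by (metis (no_types, lifting))
    then show "\<exists>H K. elementary_collapsing G E \<phi> H K \<tau>" by blast
  }
qed

section \<open>Passage along the relation R\<close>

text \<open>Equivariance makes \<open>s\<close> act on orbits, and injectivity keeps the orbits
  other than that of \<open>x\<close> distinct. As there are finitely many orbits, exactly one is
  not hit.\<close>

lemma complement_image_orbit_complement:
  assumes fin: "finite E" and s: "s \<in> carrier (End_monoid G E \<phi>)" and x: "x \<in> E"
    and inj: "inj_on s (E - orbit G \<phi> x)"
  obtains x' where "x' \<in> E" "s ` (E - orbit G \<phi> x) = E - orbit G \<phi> x'"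
proof -
  let ?O = "orbits G E \<phi>" and ?Y = "E - orbit G \<phi> x"
  let ?A = "?O - {orbit G \<phi> x}"
  have O: "?O = orbit G \<phi> ` E" by (auto simp: orbits_def)
  have finO: "finite ?O" using fin by (simp add: O)
  have A_subset: "P \<subseteq> ?Y" if P: "P \<in> ?A" for P
  proof -
    from P obtain y where y: "y \<in> E" "P = orbit G \<phi> y" "orbit G \<phi> y \<noteq> orbit G \<phi> x" by (auto simp: O)
    have "z \<notin> orbit G \<phi> x" if "z \<in> P" for z
      using that y x orbit_eq_iff[of z y] orbit_eq_iff[of z x] orbit_subset by blast
    with y orbit_subset show ?thesis by blast
  qed
  have "inj_on ((`) s) ?A"
    using A_subset inj by (meson inj_onI inj_on_image_eq_iff)
  moreover have "(`) s ` ?A \<subseteq> ?O"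
    using End_monoid_image_orbit[OF s] End_monoidD(1)[OF s] by (auto simp: O)
  moreover have "orbit G \<phi> x \<in> ?O" using x by (simp add: O)
  \<comment> \<open>With n orbits in all, \<open>?A\<close> and its image have n - 1 elements. The
    orbit of \<open>x\<close> witnesses n > 0, so the truncated subtraction is harmless.\<close>
  ultimately have "card (?O - (`) s ` ?A) = 1"
    using finO card_gt_0_iff[of ?O]
    by (subst card_Diff_subset) (auto simp: card_image finite_subset Suc_leI)
  then obtain P where P: "?O - (`) s ` ?A = {P}" by (auto simp: card_1_singleton_iff)
  then have "P \<in> ?O" by blast
  then obtain x' where x': "x' \<in> E" "P = orbit G \<phi> x'" by (auto simp: O)
  have "s ` ?Y = E - orbit G \<phi> x'"
  proof (intro equalityI subsetI)
    fix z assume "z \<in> s ` ?Y"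
    then obtain y where y: "y \<in> E" "y \<notin> orbit G \<phi> x" "z = s y" by auto
    then have "orbit G \<phi> y \<in> ?A" using x orbit_eq_iff by (auto simp: O)
    then have "s ` orbit G \<phi> y \<noteq> P" using P by blast
    then have "orbit G \<phi> z \<noteq> orbit G \<phi> x'"
      using x' y End_monoid_image_orbit[OF s] by simp
    then show "z \<in> E - orbit G \<phi> x'"
      using orbit_eq_iff x' y End_monoidD(1)[OF s] by blast
  next
    fix z assume z: "z \<in> E - orbit G \<phi> x'"
    then have "orbit G \<phi> z \<in> ?O" "orbit G \<phi> z \<noteq> P" using x' orbit_eq_iff by (auto simp: O)
    then obtain Q where Q: "Q \<in> ?A" "orbit G \<phi> z = s ` Q" using P by blast
    then show "z \<in> s ` ?Y" using A_subset[OF Q(1)] orbit_refl z by blast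
  qed
  with x' that show ?thesis by blast
qed

lemma elementary_collapsing_green_R:
  assumes fin: "finite E"
    and c: "c \<in> carrier (End_monoid G E \<phi>)" and \<eta>: "\<eta> \<in> carrier (End_monoid G E \<phi>)"
    and R: "green_R (End_monoid G E \<phi>) c \<eta>"
    and coll: "\<exists>H K. elementary_collapsing G E \<phi> H K c"
  shows "\<exists>H K. elementary_collapsing G E \<phi> H K \<eta>"
proof -
  have R': "green_R (End_monoid G E \<phi>) \<eta> c" using R by (simp add: green_R_def)
  obtain s where s: "s \<in> carrier (End_monoid G E \<phi>)" and cs: "\<And>x. x \<in> E \<Longrightarrow> c x = \<eta> (s x)"
    using green_R_factor[OF c monoid_End_monoid R'] by blast
  obtain t where t: "t \<in> carrier (End_monoid G E \<phi>)" and \<eta>t: "\<And>x. x \<in> E \<Longrightarrow> \<eta> x = c (t x)"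
    using green_R_factor[OF \<eta> monoid_End_monoid R] by blast
  obtain x where x: "x \<in> E" and inj: "inj_on c (E - orbit G \<phi> x)"
    and cx: "c x \<in> c ` (E - orbit G \<phi> x)"
    using coll elementary_collapsing_iff[OF c] by blast
  let ?Y = "E - orbit G \<phi> x"
  \<comment> \<open>Used twice: it makes \<open>s\<close> injective on \<open>?Y\<close>, as the
    orbit count requires, and \<eta> injective on the image of \<open>?Y\<close> under
    \<open>s\<close>.\<close>
  have inj_comp: "inj_on (\<eta> \<circ> s) ?Y"
    using inj cs by (subst inj_on_cong[where g = c]) auto
  obtain x' where x': "x' \<in> E" "s ` ?Y = E - orbit G \<phi> x'"
    using complement_image_orbit_complement[OF fin s x inj_on_imageI2[OF inj_comp]] by blast
  \<comment> \<open>The collapsed orbit adds no values: if \<open>c x = c y\<close> with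
    \<open>y\<close> in \<open>?Y\<close>, translating by \<open>g\<close> keeps \<open>y\<close>
    inside \<open>?Y\<close>.\<close>
  have image: "c z \<in> c ` ?Y" if z: "z \<in> E" for z
  proof (cases "z \<in> orbit G \<phi> x")
    case True
    then obtain g where g: "g \<in> carrier G" "z = \<phi> g x" by (auto simp: orbit_def)
    obtain y where y: "y \<in> ?Y" "c x = c y" using cx by auto
    have "\<phi> g y \<in> ?Y" using act_orbit_complement x y g by simp
    moreover have "c z = c (\<phi> g y)" using g x y c by (simp add: End_monoidD(2))
    ultimately show ?thesis by blast
  qed (use z in blast)
  have "\<eta> x' \<in> c ` ?Y" using image \<eta>t x' End_monoidD(1)[OF t] by simp
  also have "c ` ?Y = \<eta> ` (E - orbit G \<phi> x')"
    unfolding x'(2)[symmetric] image_image using cs by (auto intro: image_cong)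
  finally have "\<eta> x' \<in> \<eta> ` (E - orbit G \<phi> x')" .
  moreover have "inj_on \<eta> (E - orbit G \<phi> x')"
    using inj_comp x' by (metis inj_on_imageI)
  ultimately show ?thesis using elementary_collapsing_iff[OF \<eta>] x' by blast
qed

end

theorem corollary38:
  fixes G :: "('a, 'm) monoid_scheme" and X :: "'x set" and \<phi> :: "'a \<Rightarrow> 'x \<Rightarrow> 'x"
    and \<tau> \<eta> :: "'x \<Rightarrow> 'x"
  assumes "group_action G X \<phi>" and "finite X"
    and "\<tau> \<in> carrier (End_monoid G X \<phi>)" and "\<eta> \<in> carrier (End_monoid G X \<phi>)"
    and "\<exists>H K. elementary_collapsing G X \<phi> H K \<tau>"
    and "green_D (End_monoid G X \<phi>) \<tau> \<eta>"
  shows "\<exists>H K. elementary_collapsing G X \<phi> H K \<eta>"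
proof -
  interpret group_action G X \<phi> by fact
  obtain c where c: "c \<in> carrier (End_monoid G X \<phi>)"
    and L: "green_L (End_monoid G X \<phi>) \<tau> c" and R: "green_R (End_monoid G X \<phi>) c \<eta>"
    using assms(6) by (auto simp: green_D_def)
  have ker: "a \<in> X \<Longrightarrow> b \<in> X \<Longrightarrow> \<tau> a = \<tau> b \<longleftrightarrow> c a = c b" for a b
    using green_L_imp_map_kernel_eq[OF assms(3) c monoid_End_monoid L]
    by (auto simp: map_kernel_def set_eq_iff)
  \<comment> \<open>Both halves of the criterion only compare values at points of \<open>X\<close>,
    so the same \<open>x\<close> serves for \<tau> and \<open>c\<close>.\<close>
  have "\<exists>H K. elementary_collapsing G X \<phi> H K c"
    using assms(5) unfolding elementary_collapsing_iff[OF assms(3)] elementary_collapsing_iff[OF c]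
    by (auto simp: inj_on_def image_iff ker)
  then show ?thesis
    using elementary_collapsing_green_R assms(2,4) c R by blast
qed

end
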